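(* Let $R$ be a ring and let $(E,d_E)$ be a Euclidean $R$-bimodule. Then: (1) Every sub-bimodule of $E$ is a cyclic $R$-bimodule. (2) If $N$ is a nonzero sub-bimodule of $E$ then the set of cyclic generators of the $R$-bimodule $N$ contains the non-empty set $\mathcal{G}(N)$.
   Context: Rings are unital. A poset is Artinian if every descending chain in it stabilizes. A left $R$-module $E$ is Euclidean with Euclidean function $d_E:E\setminus\{0\}\to P$, $P$ a poset, if $\mathrm{im}(d_E)$ is an Artinian poset and, for any nonzero $u,v\in E$, there are $q\in R$, $r\in E$ with $u=qv+r$ and either $r=0$ or $d_E(r)<d_E(v)$. Right Euclidean modules are defined in the same way with $u=vq+r$. An $R$-bimodule $(E,d_E)$ is a Euclidean $R$-bimodule if both $({}_RE,d_E)$ and $(E_R,d_E)$ are Euclidean (with the same $d_E$). An $R$-bimodule $N$ is cyclic if $N=Re=eR$ for some $e\in N$, called a cyclic generator of $N$. For a nonzero sub-bimodule $N$, $g(N):=\min\{d_E(x):0\neq x\in N\}$ (the least value; it is presupposed to exist) and $\mathcal{G}(N):=\{x\in N: x\neq0,\ d_E(x)=g(N)\}$. *)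

theory Defs
  imports "HOL-Algebra.Module" "HOL-Algebra.Order"
begin

text \<open>The locale \<open>module\<close> of HOL-Algebra demands a commutative ring of scalars, so one-sided modules
  and bimodules over an arbitrary unital ring are set up here. The left action is the library's
  \<open>\<odot>\<close>; the right action is an additional record field.\<close>

record ('a, 'b) bimodule = "('a, 'b) module" +
  rsmult :: "['b, 'a] \<Rightarrow> 'b" (infixl \<open>\<cdot>\<index>\<close> 70)

locale left_module = R?: ring R + M?: abelian_group M
  for R :: "('a, 'm) ring_scheme" (structure) and M :: "('a, 'b, 'n) module_scheme" (structure) +
  assumes smult_closed:
      "\<lbrakk>a \<in> carrier R; x \<in> carrier M\<rbrakk> \<Longrightarrow> a \<odot>\<^bsub>M\<^esub> x \<in> carrier M"
    and smult_l_distr: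
      "\<lbrakk>a \<in> carrier R; b \<in> carrier R; x \<in> carrier M\<rbrakk> \<Longrightarrow>
        (a \<oplus>\<^bsub>R\<^esub> b) \<odot>\<^bsub>M\<^esub> x = a \<odot>\<^bsub>M\<^esub> x \<oplus>\<^bsub>M\<^esub> b \<odot>\<^bsub>M\<^esub> x"
    and smult_r_distr:
      "\<lbrakk>a \<in> carrier R; x \<in> carrier M; y \<in> carrier M\<rbrakk> \<Longrightarrow>
        a \<odot>\<^bsub>M\<^esub> (x \<oplus>\<^bsub>M\<^esub> y) = a \<odot>\<^bsub>M\<^esub> x \<oplus>\<^bsub>M\<^esub> a \<odot>\<^bsub>M\<^esub> y"
    and smult_assoc:
      "\<lbrakk>a \<in> carrier R; b \<in> carrier R; x \<in> carrier M\<rbrakk> \<Longrightarrow>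
        (a \<otimes>\<^bsub>R\<^esub> b) \<odot>\<^bsub>M\<^esub> x = a \<odot>\<^bsub>M\<^esub> (b \<odot>\<^bsub>M\<^esub> x)"
    and smult_one:
      "x \<in> carrier M \<Longrightarrow> \<one>\<^bsub>R\<^esub> \<odot>\<^bsub>M\<^esub> x = x"

locale right_module = R?: ring R + M?: abelian_group M
  for R :: "('a, 'm) ring_scheme" (structure) and M :: "('a, 'b, 'n) bimodule_scheme" (structure) +
  assumes rsmult_closed:
      "\<lbrakk>a \<in> carrier R; x \<in> carrier M\<rbrakk> \<Longrightarrow> x \<cdot>\<^bsub>M\<^esub> a \<in> carrier M"
    and rsmult_r_distr:
      "\<lbrakk>a \<in> carrier R; b \<in> carrier R; x \<in> carrier M\<rbrakk> \<Longrightarrow>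
        x \<cdot>\<^bsub>M\<^esub> (a \<oplus>\<^bsub>R\<^esub> b) = x \<cdot>\<^bsub>M\<^esub> a \<oplus>\<^bsub>M\<^esub> x \<cdot>\<^bsub>M\<^esub> b"
    and rsmult_l_distr:
      "\<lbrakk>a \<in> carrier R; x \<in> carrier M; y \<in> carrier M\<rbrakk> \<Longrightarrow>
        (x \<oplus>\<^bsub>M\<^esub> y) \<cdot>\<^bsub>M\<^esub> a = x \<cdot>\<^bsub>M\<^esub> a \<oplus>\<^bsub>M\<^esub> y \<cdot>\<^bsub>M\<^esub> a"
    and rsmult_assoc:
      "\<lbrakk>a \<in> carrier R; b \<in> carrier R; x \<in> carrier M\<rbrakk> \<Longrightarrow>
        x \<cdot>\<^bsub>M\<^esub> (a \<otimes>\<^bsub>R\<^esub> b) = (x \<cdot>\<^bsub>M\<^esub> a) \<cdot>\<^bsub>M\<^esub> b"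
    and rsmult_one:
      "x \<in> carrier M \<Longrightarrow> x \<cdot>\<^bsub>M\<^esub> \<one>\<^bsub>R\<^esub> = x"

locale bimodule = left_module R M + right_module R M
  for R :: "('a, 'm) ring_scheme" (structure) and M :: "('a, 'b, 'n) bimodule_scheme" (structure) +
  assumes smult_rsmult_assoc:
    "\<lbrakk>a \<in> carrier R; b \<in> carrier R; x \<in> carrier M\<rbrakk> \<Longrightarrow>
      (a \<odot>\<^bsub>M\<^esub> x) \<cdot>\<^bsub>M\<^esub> b = a \<odot>\<^bsub>M\<^esub> (x \<cdot>\<^bsub>M\<^esub> b)"

locale sub_bimodule = submodule N R M
  for N and R :: "('a, 'm) ring_scheme" and M :: "('a, 'b, 'n) bimodule_scheme" (structure) +
  assumes rsmult_closed: "\<lbrakk>a \<in> carrier R; x \<in> N\<rbrakk> \<Longrightarrow> x \<cdot>\<^bsub>M\<^esub> a \<in> N"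

definition cyclic_generator ::
  "('a, 'm) ring_scheme \<Rightarrow> ('a, 'b, 'n) bimodule_scheme \<Rightarrow> 'b \<Rightarrow> bool" where
  "cyclic_generator R M e \<longleftrightarrow> e \<in> carrier M \<and>
     carrier M = {a \<odot>\<^bsub>M\<^esub> e | a. a \<in> carrier R} \<and>
     carrier M = {e \<cdot>\<^bsub>M\<^esub> a | a. a \<in> carrier R}"

definition cyclic_bimodule ::
  "('a, 'm) ring_scheme \<Rightarrow> ('a, 'b, 'n) bimodule_scheme \<Rightarrow> bool" where
  "cyclic_bimodule R M \<longleftrightarrow> bimodule R M \<and> (\<exists>e. cyclic_generator R M e)"

definition artinian_poset :: "('p, 'q) gorder_scheme \<Rightarrow> bool" where
  "artinian_poset P \<longleftrightarrow> partial_order P \<and>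
     (\<forall>f :: nat \<Rightarrow> 'p. (\<forall>n. f n \<in> carrier P) \<and> (\<forall>n. f (Suc n) \<sqsubseteq>\<^bsub>P\<^esub> f n) \<longrightarrow>
        (\<exists>m. \<forall>n\<ge>m. f n = f m))"

text \<open>A Euclidean function has domain \<open>carrier M - {\<zero>\<^bsub>M\<^esub>}\<close>; the value of the total function \<open>d\<close>
  at \<open>\<zero>\<^bsub>M\<^esub>\<close> is never used. Its image carries the order induced from \<open>P\<close>.\<close>

definition euclidean_function ::
  "('a, 'b, 'n) module_scheme \<Rightarrow> ('p, 'q) gorder_scheme \<Rightarrow> ('b \<Rightarrow> 'p) \<Rightarrow> bool" where
  "euclidean_function M P d \<longleftrightarrow> partial_order P \<and>
     d \<in> carrier M - {\<zero>\<^bsub>M\<^esub>} \<rightarrow> carrier P \<and>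
     artinian_poset (P\<lparr>carrier := d ` (carrier M - {\<zero>\<^bsub>M\<^esub>})\<rparr>)"

definition euclidean_left_module ::
  "('a, 'm) ring_scheme \<Rightarrow> ('a, 'b, 'n) module_scheme \<Rightarrow> ('p, 'q) gorder_scheme \<Rightarrow> ('b \<Rightarrow> 'p) \<Rightarrow> bool"
  where
  "euclidean_left_module R M P d \<longleftrightarrow> left_module R M \<and> euclidean_function M P d \<and>
     (\<forall>u \<in> carrier M - {\<zero>\<^bsub>M\<^esub>}. \<forall>v \<in> carrier M - {\<zero>\<^bsub>M\<^esub>}.
        \<exists>q \<in> carrier R. \<exists>r \<in> carrier M.
          u = q \<odot>\<^bsub>M\<^esub> v \<oplus>\<^bsub>M\<^esub> r \<and> (r = \<zero>\<^bsub>M\<^esub> \<or> d r \<sqsubset>\<^bsub>P\<^esub> d v))"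

definition euclidean_right_module ::
  "('a, 'm) ring_scheme \<Rightarrow> ('a, 'b, 'n) bimodule_scheme \<Rightarrow> ('p, 'q) gorder_scheme \<Rightarrow> ('b \<Rightarrow> 'p) \<Rightarrow> bool"
  where
  "euclidean_right_module R M P d \<longleftrightarrow> right_module R M \<and> euclidean_function M P d \<and>
     (\<forall>u \<in> carrier M - {\<zero>\<^bsub>M\<^esub>}. \<forall>v \<in> carrier M - {\<zero>\<^bsub>M\<^esub>}.
        \<exists>q \<in> carrier R. \<exists>r \<in> carrier M.
          u = v \<cdot>\<^bsub>M\<^esub> q \<oplus>\<^bsub>M\<^esub> r \<and> (r = \<zero>\<^bsub>M\<^esub> \<or> d r \<sqsubset>\<^bsub>P\<^esub> d v))"

definition euclidean_bimodule ::
  "('a, 'm) ring_scheme \<Rightarrow> ('a, 'b, 'n) bimodule_scheme \<Rightarrow> ('p, 'q) gorder_scheme \<Rightarrow> ('b \<Rightarrow> 'p) \<Rightarrow> bool"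
  where
  "euclidean_bimodule R M P d \<longleftrightarrow> bimodule R M \<and>
     euclidean_left_module R M P d \<and> euclidean_right_module R M P d"

text \<open>\<open>g(N)\<close> and \<open>\<G>(N)\<close>. The values of \<open>d\<close> on \<open>N\<close> need not have a least element (the image of
  \<open>d\<close> is only Artinian, not totally ordered); both notions are meaningful only when
  \<open>has_least_value\<close> holds.\<close>

definition has_least_value ::
  "('a, 'b, 'n) module_scheme \<Rightarrow> ('p, 'q) gorder_scheme \<Rightarrow> ('b \<Rightarrow> 'p) \<Rightarrow> 'b set \<Rightarrow> bool" where
  "has_least_value M P d N \<longleftrightarrow> (\<exists>m. least P m (d ` (N - {\<zero>\<^bsub>M\<^esub>})))"

definition least_value ::
  "('a, 'b, 'n) module_scheme \<Rightarrow> ('p, 'q) gorder_scheme \<Rightarrow> ('b \<Rightarrow> 'p) \<Rightarrow> 'b set \<Rightarrow> 'p" where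
  "least_value M P d N = (THE m. least P m (d ` (N - {\<zero>\<^bsub>M\<^esub>})))"

definition least_value_elements ::
  "('a, 'b, 'n) module_scheme \<Rightarrow> ('p, 'q) gorder_scheme \<Rightarrow> ('b \<Rightarrow> 'p) \<Rightarrow> 'b set \<Rightarrow> 'b set" where
  "least_value_elements M P d N = {x \<in> N. x \<noteq> \<zero>\<^bsub>M\<^esub> \<and> d x = least_value M P d N}"

end

theory Submission
  imports Defs "HOL-Algebra.AbelCoset"
begin

text \<open>An element of \<open>N\<close> whose Euclidean value is minimal among those of the nonzero elements of
  \<open>N\<close> divides every element of \<open>N\<close> from either side: the remainder stays in \<open>N\<close> and cannot have a
  strictly smaller value, so it vanishes. Minimal values exist by the Artinian condition, and a
  least value is in particular minimal.\<close>

text \<open>Without a minimal element of \<open>A\<close>, dependent choice would give a strictly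
  descending sequence in \<open>A\<close>, which can never stabilize.\<close>

lemma artinian_poset_minimal:
  assumes "artinian_poset P" and "A \<subseteq> carrier P" and "A \<noteq> {}"
  shows "\<exists>m\<in>A. \<forall>x\<in>A. \<not> x \<sqsubset>\<^bsub>P\<^esub> m"
proof (rule ccontr)
  assume "\<not> ?thesis"
  then have step: "\<exists>x. x \<in> A \<and> x \<sqsubset>\<^bsub>P\<^esub> m" if "m \<in> A" for m
    using that by blast
  obtain a where "a \<in> A"
    using assms(3) by blast
  then obtain f where f: "\<And>n. f n \<in> A" and desc: "\<And>n. f (Suc n) \<sqsubset>\<^bsub>P\<^esub> f n"
    using dependent_nat_choice[of "\<lambda>_ x. x \<in> A" "\<lambda>_ x y. y \<sqsubset>\<^bsub>P\<^esub> x"] step by blast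
  have "(\<forall>n. f n \<in> carrier P) \<and> (\<forall>n. f (Suc n) \<sqsubseteq>\<^bsub>P\<^esub> f n)"
    using f assms(2) desc by (blast intro: lless_imp_le)
  then have "\<exists>m. \<forall>n\<ge>m. f n = f m"
    using assms(1) unfolding artinian_poset_def by simp
  then obtain m where "f (Suc m) = f m"
    by (metis le_Suc_eq order_refl)
  \<comment> \<open>In a general ordered structure \<open>lless\<close> excludes only the
    structure's own equivalence; in a partial order that is equality, so
    \<open>f (Suc m) = f m\<close> contradicts strict descent.\<close>
  moreover have "partial_order P"
    using assms(1) unfolding artinian_poset_def by blast
  ultimately show False
    using desc[of m] partial_order.lless_eq by metis
qed

text \<open>The Artinian condition concerns the image of \<open>d\<close> with its induced order,
  whereas remainders are compared in \<open>P\<close>; this lets minimality pass from the one to the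
  other.\<close>

lemma lless_restrict_carrier: "x \<sqsubset>\<^bsub>P\<lparr>carrier := A\<rparr>\<^esub> y \<longleftrightarrow> x \<sqsubset>\<^bsub>P\<^esub> y"
  by (simp add: lless_def)

context left_module
begin

lemma smult_l_null:
  assumes "x \<in> carrier M"
  shows "\<zero>\<^bsub>R\<^esub> \<odot>\<^bsub>M\<^esub> x = \<zero>\<^bsub>M\<^esub>"
proof -
  have "\<zero>\<^bsub>R\<^esub> \<odot>\<^bsub>M\<^esub> x \<in> carrier M"
    using assms by (simp add: smult_closed)
  moreover have "\<zero>\<^bsub>R\<^esub> \<odot>\<^bsub>M\<^esub> x \<oplus>\<^bsub>M\<^esub> \<zero>\<^bsub>R\<^esub> \<odot>\<^bsub>M\<^esub> x = \<zero>\<^bsub>R\<^esub> \<odot>\<^bsub>M\<^esub> x"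
    using smult_l_distr[of "\<zero>\<^bsub>R\<^esub>" "\<zero>\<^bsub>R\<^esub>" x] assms by simp
  ultimately show ?thesis
    by simp
qed

end

context right_module
begin

lemma rsmult_r_null:
  assumes "x \<in> carrier M"
  shows "x \<cdot>\<^bsub>M\<^esub> \<zero>\<^bsub>R\<^esub> = \<zero>\<^bsub>M\<^esub>"
proof -
  have "x \<cdot>\<^bsub>M\<^esub> \<zero>\<^bsub>R\<^esub> \<in> carrier M"
    using assms by (simp add: rsmult_closed)
  moreover have "x \<cdot>\<^bsub>M\<^esub> \<zero>\<^bsub>R\<^esub> \<oplus>\<^bsub>M\<^esub> x \<cdot>\<^bsub>M\<^esub> \<zero>\<^bsub>R\<^esub> = x \<cdot>\<^bsub>M\<^esub> \<zero>\<^bsub>R\<^esub>"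
    using rsmult_r_distr[of "\<zero>\<^bsub>R\<^esub>" "\<zero>\<^bsub>R\<^esub>" x] assms by simp
  ultimately show ?thesis
    by simp
qed

end

context abelian_group
begin

text \<open>Restricting the carrier commutes with passing to the additive monoid, so the results on
  submonoids and subgroups apply there.\<close>

lemma additive_subgroup_is_abelian_group:
  assumes "additive_subgroup H G"
  shows "abelian_group (G\<lparr>carrier := H\<rparr>)"
proof -
  have sub: "subgroup H (add_monoid G)"
    using assms by (rule additive_subgroup.a_subgroup)
  have "abelian_monoid (G\<lparr>carrier := H\<rparr>)"
    using comm_monoid.submonoid_is_comm_monoid[OF a_comm_monoid subgroup.subgroup_is_submonoid[OF sub]]
    by (simp add: abelian_monoid_def)
  moreover have "abelian_group_axioms (G\<lparr>carrier := H\<rparr>)"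
    using subgroup.subgroup_is_group[OF sub a_group] calculation
    by (simp add: abelian_group_axioms_def comm_group_def abelian_monoid_def)
  ultimately show ?thesis
    by (rule abelian_group.intro)
qed

text \<open>Cancelling \<open>x\<close> recovers \<open>r\<close> as
  \<open>\<ominus> x \<oplus> (x \<oplus> r)\<close>. This is what keeps remainders inside a
  sub-bimodule.\<close>

lemma additive_subgroup_summand:
  assumes "additive_subgroup H G" and "x \<in> H" and "r \<in> carrier G" and "x \<oplus> r \<in> H"
  shows "r \<in> H"
proof -
  have x: "x \<in> carrier G"
    using assms(1,2) additive_subgroup.a_subset by blast
  have "\<ominus> x \<oplus> (x \<oplus> r) \<in> H"
    using assms by (simp add: additive_subgroup.a_closed additive_subgroup.a_inv_closed)
  with x assms(3) show ?thesis
    by (simp add: r_neg1)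
qed

end

lemma sub_bimodule_additive_subgroup:
  "sub_bimodule N R M \<Longrightarrow> additive_subgroup N M"
  by (simp add: additive_subgroup_def sub_bimodule_def submodule_def)

text \<open>The module identities are inherited from \<open>M\<close>, and the closure conditions
  come from \<open>N\<close>. Besides a generator, \<open>cyclic_bimodule\<close> asks for exactly
  this.\<close>

lemma sub_bimodule_is_bimodule:
  assumes "bimodule R M" and "sub_bimodule N R M"
  shows "bimodule R (M\<lparr>carrier := N\<rparr>)"
proof -
  interpret bimodule R M by fact
  interpret N: sub_bimodule N R M by fact
  have add: "additive_subgroup N M"
    using assms(2) by (rule sub_bimodule_additive_subgroup)
  have in_M: "\<And>x. x \<in> N \<Longrightarrow> x \<in> carrier M"
    using additive_subgroup.a_subset[OF add] by blast
  have "abelian_group (M\<lparr>carrier := N\<rparr>)"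
    using add by (rule M.additive_subgroup_is_abelian_group)
  then show ?thesis
    by (intro bimodule.intro left_module.intro right_module.intro left_module_axioms.intro
        right_module_axioms.intro bimodule_axioms.intro R.ring_axioms)
      (simp_all add: in_M N.smult_closed N.rsmult_closed smult_l_distr smult_r_distr smult_assoc
        smult_one rsmult_l_distr rsmult_r_distr rsmult_assoc rsmult_one smult_rsmult_assoc)
qed

text \<open>Stated for minimal values so as to serve both claims: the Artinian condition yields a
  minimal value, and a least value is minimal.\<close>

lemma cyclic_generator_if_minimal:
  assumes E: "euclidean_bimodule R E P d" and N: "sub_bimodule N R E"
    and e: "e \<in> N" "e \<noteq> \<zero>\<^bsub>E\<^esub>"
    and min: "\<And>x. x \<in> N \<Longrightarrow> x \<noteq> \<zero>\<^bsub>E\<^esub> \<Longrightarrow> \<not> d x \<sqsubset>\<^bsub>P\<^esub> d e"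
  shows "cyclic_generator R (E\<lparr>carrier := N\<rparr>) e"
proof -
  have "bimodule R E"
    using E by (simp add: euclidean_bimodule_def)
  then interpret bimodule R E .
  interpret N: sub_bimodule N R E by fact
  have add: "additive_subgroup N E"
    using N by (rule sub_bimodule_additive_subgroup)
  have in_E: "\<And>x. x \<in> N \<Longrightarrow> x \<in> carrier E"
    using additive_subgroup.a_subset[OF add] by blast
  have left: "\<exists>a\<in>carrier R. u = a \<odot>\<^bsub>E\<^esub> e" if u: "u \<in> N" for u
  proof (cases "u = \<zero>\<^bsub>E\<^esub>")
    \<comment> \<open>Division with remainder is available for nonzero \<open>u\<close> only; zero
      is reached with the scalar zero.\<close>
    case True
    then show ?thesis
      using smult_l_null[OF in_E[OF e(1)]] R.zero_closed by metis
  next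
    case False
    then obtain q r where qr: "q \<in> carrier R" "r \<in> carrier E" "u = q \<odot>\<^bsub>E\<^esub> e \<oplus>\<^bsub>E\<^esub> r"
      "r = \<zero>\<^bsub>E\<^esub> \<or> d r \<sqsubset>\<^bsub>P\<^esub> d e"
      using E u e in_E unfolding euclidean_bimodule_def euclidean_left_module_def by blast
    \<comment> \<open>Both \<open>u\<close> and the multiple of \<open>e\<close> lie in
      \<open>N\<close>, hence so does their difference, and \<open>min\<close> becomes applicable to
      \<open>r\<close>.\<close>
    have "r \<in> N"
      using M.additive_subgroup_summand[OF add, of "q \<odot>\<^bsub>E\<^esub> e" r] qr e(1) u N.smult_closed by simp
    then have "r = \<zero>\<^bsub>E\<^esub>"
      using qr(4) min by blast
    with qr e(1) show ?thesis
      by (auto simp: smult_closed in_E)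
  qed
  have right: "\<exists>a\<in>carrier R. u = e \<cdot>\<^bsub>E\<^esub> a" if u: "u \<in> N" for u
  proof (cases "u = \<zero>\<^bsub>E\<^esub>")
    case True
    then show ?thesis
      using rsmult_r_null[OF in_E[OF e(1)]] R.zero_closed by metis
  next
    case False
    then obtain q r where qr: "q \<in> carrier R" "r \<in> carrier E" "u = e \<cdot>\<^bsub>E\<^esub> q \<oplus>\<^bsub>E\<^esub> r"
      "r = \<zero>\<^bsub>E\<^esub> \<or> d r \<sqsubset>\<^bsub>P\<^esub> d e"
      using E u e in_E unfolding euclidean_bimodule_def euclidean_right_module_def by blast
    have "r \<in> N"
      using M.additive_subgroup_summand[OF add, of "e \<cdot>\<^bsub>E\<^esub> q" r] qr e(1) u N.rsmult_closed by simp
    then have "r = \<zero>\<^bsub>E\<^esub>"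
      using qr(4) min by blast
    with qr e(1) show ?thesis
      by (auto simp: rsmult_closed in_E)
  qed
  show ?thesis
    \<comment> \<open>\<open>left\<close> and \<open>right\<close> show that the multiples of
      \<open>e\<close> exhaust \<open>N\<close>; closure under both actions gives the reverse
      inclusions.\<close>
    using left right e(1) N.smult_closed N.rsmult_closed
    unfolding cyclic_generator_def by auto
qed

text \<open>The zero sub-bimodule has no nonzero element on which to minimize \<open>d\<close>, so
  it is treated separately. Either action fixes zero, because the result equals its own double and
  cancels.\<close>

lemma cyclic_generator_zero:
  assumes "bimodule R M"
  shows "cyclic_generator R (M\<lparr>carrier := {\<zero>\<^bsub>M\<^esub>}\<rparr>) \<zero>\<^bsub>M\<^esub>"
proof -
  interpret bimodule R M by fact
  have "a \<odot>\<^bsub>M\<^esub> \<zero>\<^bsub>M\<^esub> = \<zero>\<^bsub>M\<^esub>" if "a \<in> carrier R" for a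
    using smult_r_distr[OF that, of "\<zero>\<^bsub>M\<^esub>" "\<zero>\<^bsub>M\<^esub>"] smult_closed[OF that, of "\<zero>\<^bsub>M\<^esub>"] by simp
  moreover have "\<zero>\<^bsub>M\<^esub> \<cdot>\<^bsub>M\<^esub> a = \<zero>\<^bsub>M\<^esub>" if "a \<in> carrier R" for a
    using rsmult_l_distr[OF that, of "\<zero>\<^bsub>M\<^esub>" "\<zero>\<^bsub>M\<^esub>"] rsmult_closed[OF that, of "\<zero>\<^bsub>M\<^esub>"] by simp
  ultimately show ?thesis
    using R.zero_closed unfolding cyclic_generator_def by force
qed

lemma cyclic_bimodule_sub_bimodule:
  assumes E: "euclidean_bimodule R E P d" and N: "sub_bimodule N R E"
  shows "cyclic_bimodule R (E\<lparr>carrier := N\<rparr>)"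
proof -
  have bi: "bimodule R E"
    using E by (simp add: euclidean_bimodule_def)
  have add: "additive_subgroup N E"
    using N by (rule sub_bimodule_additive_subgroup)
  have "\<exists>e. cyclic_generator R (E\<lparr>carrier := N\<rparr>) e"
  proof (cases "N = {\<zero>\<^bsub>E\<^esub>}")
    case True
    then show ?thesis
      using cyclic_generator_zero[OF bi] by blast
  next
    case False
    let ?P = "P\<lparr>carrier := d ` (carrier E - {\<zero>\<^bsub>E\<^esub>})\<rparr>"
    have "artinian_poset ?P"
      using E by (simp add: euclidean_bimodule_def euclidean_left_module_def
          euclidean_function_def)
    moreover have "d ` (N - {\<zero>\<^bsub>E\<^esub>}) \<subseteq> carrier ?P"
      using additive_subgroup.a_subset[OF add] by auto
    \<comment> \<open>Since \<open>N\<close> contains zero and differs from the zero subgroup, it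
      has a nonzero element.\<close>
    moreover have "d ` (N - {\<zero>\<^bsub>E\<^esub>}) \<noteq> {}"
      using False additive_subgroup.zero_closed[OF add] by auto
    ultimately obtain e where "e \<in> N" "e \<noteq> \<zero>\<^bsub>E\<^esub>"
      "\<And>x. x \<in> N \<Longrightarrow> x \<noteq> \<zero>\<^bsub>E\<^esub> \<Longrightarrow> \<not> d x \<sqsubset>\<^bsub>P\<^esub> d e"
      using artinian_poset_minimal[of ?P "d ` (N - {\<zero>\<^bsub>E\<^esub>})"]
      unfolding lless_restrict_carrier by blast
    then show ?thesis
      using cyclic_generator_if_minimal[OF E N] by blast
  qed
  with sub_bimodule_is_bimodule[OF bi N] show ?thesis
    by (simp add: cyclic_bimodule_def)
qed

text \<open>Least elements of a partial order are unique, so the definite description in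
  \<open>least_value\<close> is meaningful.\<close>

lemma least_least_value:
  assumes "partial_order P" and "has_least_value M P d N"
  shows "least P (least_value M P d N) (d ` (N - {\<zero>\<^bsub>M\<^esub>}))"
proof -
  have "\<exists>!m. least P m (d ` (N - {\<zero>\<^bsub>M\<^esub>}))"
    using assms partial_order.least_unique unfolding has_least_value_def by metis
  then show ?thesis
    unfolding least_value_def by (rule theI')
qed

text \<open>An \<open>x\<close> strictly below \<open>m\<close> would also lie above it, and
  antisymmetry would make the two equal.\<close>

lemma (in partial_order) least_imp_minimal:
  assumes "least L m A" and "x \<in> A"
  shows "\<not> x \<sqsubset> m"
  using assms le_antisym[of m x] unfolding least_def lless_eq by blast

theorem lemma4p14:
  fixes R :: "('a, 'm) ring_scheme"
    and E :: "('a, 'b, 'n) bimodule_scheme"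
    and P :: "('p, 'q) gorder_scheme"
    and d :: "'b \<Rightarrow> 'p"
  assumes "ring R"
    and "euclidean_bimodule R E P d"
  shows "(\<forall>N. sub_bimodule N R E \<longrightarrow> cyclic_bimodule R (E\<lparr>carrier := N\<rparr>)) \<and>
    (\<forall>N. sub_bimodule N R E \<and> N \<noteq> {\<zero>\<^bsub>E\<^esub>} \<and> has_least_value E P d N \<longrightarrow>
       least_value_elements E P d N \<noteq> {} \<and>
       least_value_elements E P d N \<subseteq> {e. cyclic_generator R (E\<lparr>carrier := N\<rparr>) e})"
proof (intro conjI allI impI)
  fix N
  assume "sub_bimodule N R E"
  with assms(2) show "cyclic_bimodule R (E\<lparr>carrier := N\<rparr>)"
    by (rule cyclic_bimodule_sub_bimodule)
next
  fix N
  assume N: "sub_bimodule N R E \<and> N \<noteq> {\<zero>\<^bsub>E\<^esub>} \<and> has_least_value E P d N"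
  have po: "partial_order P"
    using assms(2)
    by (simp add: euclidean_bimodule_def euclidean_left_module_def euclidean_function_def)
  then have least: "least P (least_value E P d N) (d ` (N - {\<zero>\<^bsub>E\<^esub>}))"
    using N by (blast intro: least_least_value)
  \<comment> \<open>A least element belongs to its set, so the least value is attained at some
    nonzero element of \<open>N\<close>.\<close>
  then show "least_value_elements E P d N \<noteq> {}"
    unfolding least_def least_value_elements_def by auto
  show "least_value_elements E P d N \<subseteq> {e. cyclic_generator R (E\<lparr>carrier := N\<rparr>) e}"
  proof
    fix e
    assume e: "e \<in> least_value_elements E P d N"
    then have "\<not> d x \<sqsubset>\<^bsub>P\<^esub> d e" if "x \<in> N" "x \<noteq> \<zero>\<^bsub>E\<^esub>" for x
      using partial_order.least_imp_minimal[OF po least, of "d x"] that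
      unfolding least_value_elements_def by simp
    with e N show "e \<in> {e. cyclic_generator R (E\<lparr>carrier := N\<rparr>) e}"
      using cyclic_generator_if_minimal[OF assms(2)]
      unfolding least_value_elements_def by blast
  qed
qed

end
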